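(* Fix $q\ge 1$. The mapping $\Gamma:\widetilde{\mathbb{Q}}\to\tilde{\mathbb{I}}$, $\langle\mu,\nu\rangle\mapsto\langle\mu^q,\nu^q\rangle$, is an isomorphism between the posets $(\tilde{\mathbb{I}},\leq_{\mathrm{XY}})$ and $(\widetilde{\mathbb{Q}},\leq_{\mathrm{LW}})$.
   Context: $\tilde{\mathbb{I}}=\{\langle\mu,\nu\rangle\in[0,1]^2 \mid \mu+\nu\le 1\}$ is the set of intuitionistic fuzzy values. For $\alpha=\langle\mu_\alpha,\nu_\alpha\rangle\in\tilde{\mathbb{I}}$ put $s(\alpha)=\mu_\alpha-\nu_\alpha$ and $h(\alpha)=\mu_\alpha+\nu_\alpha$. Define $\alpha<_{\mathrm{XY}}\beta$ iff $s(\alpha)<s(\beta)$, or $s(\alpha)=s(\beta)$ and $h(\alpha)<h(\beta)$; $\alpha\leq_{\mathrm{XY}}\beta$ iff $\alpha<_{\mathrm{XY}}\beta$ or $\alpha=\beta$. For $q\ge1$, $\widetilde{\mathbb{Q}}=\{\langle\mu,\nu\rangle\in[0,1]^2 \mid \mu^q+\nu^q\le 1\}$ is the set of q-rung orthopair fuzzy numbers. For $\alpha=\langle\mu_\alpha,\nu_\alpha\rangle\in\widetilde{\mathbb{Q}}$ put $s_{\mathrm{LW}}(\alpha)=(\mu_\alpha)^q-(\nu_\alpha)^q$ and $h_{\mathrm{LW}}(\alpha)=(\mu_\alpha)^q+(\nu_\alpha)^q$. Define $\alpha<_{\mathrm{LW}}\beta$ iff $s_{\mathrm{LW}}(\alpha)<s_{\mathrm{LW}}(\beta)$,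 or $s_{\mathrm{LW}}(\alpha)=s_{\mathrm{LW}}(\beta)$ and $h_{\mathrm{LW}}(\alpha)<h_{\mathrm{LW}}(\beta)$; $\alpha\leq_{\mathrm{LW}}\beta$ iff $\alpha<_{\mathrm{LW}}\beta$ or $\alpha=\beta$. An isomorphism of posets is a bijection $f$ such that both $f$ and $f^{-1}$ are order preserving. *)

theory Defs
  imports Complex_Main
begin

definition poset_on :: "'a set \<Rightarrow> ('a \<Rightarrow> 'a \<Rightarrow> bool) \<Rightarrow> bool" where
  "poset_on A le \<longleftrightarrow> reflp_on A le \<and> antisymp_on A le \<and> transp_on A le"

definition poset_isomorphism ::
  "'a set \<Rightarrow> ('a \<Rightarrow> 'a \<Rightarrow> bool) \<Rightarrow> 'b set \<Rightarrow> ('b \<Rightarrow> 'b \<Rightarrow> bool) \<Rightarrow> ('a \<Rightarrow> 'b) \<Rightarrow> bool" where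
  "poset_isomorphism A leA B leB f \<longleftrightarrow>
     poset_on A leA \<and> poset_on B leB \<and> bij_betw f A B \<and>
     monotone_on A leA leB f \<and> monotone_on B leB leA (inv_into A f)"

definition IFV :: "(real \<times> real) set" where
  "IFV = {(\<mu>, \<nu>). \<mu> \<in> {0..1} \<and> \<nu> \<in> {0..1} \<and> \<mu> + \<nu> \<le> 1}"

definition s_IFV :: "real \<times> real \<Rightarrow> real" where
  "s_IFV \<alpha> = fst \<alpha> - snd \<alpha>"

definition h_IFV :: "real \<times> real \<Rightarrow> real" where
  "h_IFV \<alpha> = fst \<alpha> + snd \<alpha>"

definition less_XY :: "real \<times> real \<Rightarrow> real \<times> real \<Rightarrow> bool" where
  "less_XY \<alpha> \<beta> \<longleftrightarrow>
     s_IFV \<alpha> < s_IFV \<beta> \<or> (s_IFV \<alpha> = s_IFV \<beta> \<and> h_IFV \<alpha> < h_IFV \<beta>)"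

definition le_XY :: "real \<times> real \<Rightarrow> real \<times> real \<Rightarrow> bool" where
  "le_XY \<alpha> \<beta> \<longleftrightarrow> less_XY \<alpha> \<beta> \<or> \<alpha> = \<beta>"

text \<open>The exponent \<open>q\<close> is real. On the nonnegative reals, \<open>powr\<close> with exponent \<open>q \<ge> 1\<close>
  is the usual power, including \<open>0 powr q = 0\<close>.\<close>

definition QROFN :: "real \<Rightarrow> (real \<times> real) set" where
  "QROFN q = {(\<mu>, \<nu>). \<mu> \<in> {0..1} \<and> \<nu> \<in> {0..1} \<and> \<mu> powr q + \<nu> powr q \<le> 1}"

definition s_LW :: "real \<Rightarrow> real \<times> real \<Rightarrow> real" where
  "s_LW q \<alpha> = fst \<alpha> powr q - snd \<alpha> powr q"

definition h_LW :: "real \<Rightarrow> real \<times> real \<Rightarrow> real" where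
  "h_LW q \<alpha> = fst \<alpha> powr q + snd \<alpha> powr q"

definition less_LW :: "real \<Rightarrow> real \<times> real \<Rightarrow> real \<times> real \<Rightarrow> bool" where
  "less_LW q \<alpha> \<beta> \<longleftrightarrow>
     s_LW q \<alpha> < s_LW q \<beta> \<or> (s_LW q \<alpha> = s_LW q \<beta> \<and> h_LW q \<alpha> < h_LW q \<beta>)"

definition le_LW :: "real \<Rightarrow> real \<times> real \<Rightarrow> real \<times> real \<Rightarrow> bool" where
  "le_LW q \<alpha> \<beta> \<longleftrightarrow> less_LW q \<alpha> \<beta> \<or> \<alpha> = \<beta>"

definition Gamma_map :: "real \<Rightarrow> real \<times> real \<Rightarrow> real \<times> real" where
  "Gamma_map q = (\<lambda>(\<mu>, \<nu>). (\<mu> powr q, \<nu> powr q))"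

end

theory Submission
  imports Defs
begin

text \<open>Substituting \<open>Gamma_map q\<close> into the score and accuracy of the XY order
  gives exactly those of the LW order, so the two strict relations correspond
  (\<open>less_LW_iff_less_XY_Gamma_map\<close>). Since x \<mapsto> x^q is invertible on [0,1], the
  map is a bijection onto \<open>IFV\<close> (\<open>bij_betw_Gamma_map\<close>), and equality
  corresponds as well. Hence \<open>le_LW q\<close> is the pullback of \<open>le_XY\<close> along a
  bijection. A pullback of this kind inherits the partial order axioms, so these are checked by hand
  only for \<open>le_XY\<close>.\<close>

lemma poset_isomorphism_order_embedding:
  assumes bij: "bij_betw f A B" and B: "poset_on B leB"
    and iff: "\<And>x y. x \<in> A \<Longrightarrow> y \<in> A \<Longrightarrow> leA x y \<longleftrightarrow> leB (f x) (f y)"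
  shows "poset_isomorphism A leA B leB f"
proof -
  have inj: "inj_on f A" and fB: "\<And>x. x \<in> A \<Longrightarrow> f x \<in> B"
    using bij by (auto simp: bij_betw_def)
  have inv: "inv_into A f y \<in> A" "f (inv_into A f y) = y" if "y \<in> B" for y
    using that bij by (auto simp: bij_betw_def inv_into_into f_inv_into_f)
  have "reflp_on A leA"
    using B fB iff by (auto simp: poset_on_def reflp_on_def)
  moreover have "antisymp_on A leA"
  proof (rule antisymp_onI)
    fix x y assume "x \<in> A" "y \<in> A" "leA x y" "leA y x"
    \<comment> \<open>Antisymmetry in the target only identifies the images; injectivity of
      \<open>f\<close> then brings the equality back to \<open>A\<close>.\<close>
    then have "f x = f y"
      using B fB iff by (meson poset_on_def antisymp_onD)
    with \<open>x \<in> A\<close> \<open>y \<in> A\<close> show "x = y"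
      using inj by (simp add: inj_on_eq_iff)
  qed
  moreover have "transp_on A leA"
  proof (rule transp_onI)
    fix x y z assume "x \<in> A" "y \<in> A" "z \<in> A" "leA x y" "leA y z"
    then show "leA x z"
      using B fB iff by (meson poset_on_def transp_onD)
  qed
  moreover have "monotone_on A leA leB f"
    using iff by (simp add: monotone_on_def)
  \<comment> \<open>Each point of \<open>B\<close> is the image of its preimage, so this is the
    order-reflecting half of \<open>iff\<close>.\<close>
  moreover have "monotone_on B leB leA (inv_into A f)"
    using iff inv by (simp add: monotone_on_def)
  ultimately show ?thesis
    using bij B by (simp add: poset_isomorphism_def poset_on_def)
qed

text \<open>Comparing (s, h) lexicographically is irreflexive and transitive on all real pairs, so
  its reflexive closure is a partial order on any \<open>A\<close>.\<close>

lemma poset_on_le_XY: "poset_on A le_XY"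
  unfolding poset_on_def
proof (intro conjI)
  show "reflp_on A le_XY"
    by (simp add: reflp_on_def le_XY_def)
  show "antisymp_on A le_XY"
    by (rule antisymp_onI) (auto simp: le_XY_def less_XY_def)
  show "transp_on A le_XY"
    by (rule transp_onI) (auto simp: le_XY_def less_XY_def)
qed

text \<open>The inverse takes q-th roots, as (x^q)^(1/q) = x for x \<ge> 0. The constraint \<mu>^q +
  \<nu>^q \<le> 1 is the condition \<mu> + \<nu> \<le> 1 on the image, and both maps keep
  coordinates in [0,1].\<close>

lemma bij_betw_Gamma_map:
  assumes "q > 0"
  shows "bij_betw (Gamma_map q) (QROFN q) IFV"
proof (rule bij_betw_byWitness[where f' = "Gamma_map (1 / q)"])
  show "\<forall>a\<in>QROFN q. Gamma_map (1 / q) (Gamma_map q a) = a"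
    using assms by (auto simp: QROFN_def Gamma_map_def powr_powr)
  show "\<forall>b\<in>IFV. Gamma_map q (Gamma_map (1 / q) b) = b"
    using assms by (auto simp: IFV_def Gamma_map_def powr_powr)
  show "Gamma_map q ` QROFN q \<subseteq> IFV"
    using assms by (auto simp: IFV_def QROFN_def Gamma_map_def powr_le1)
  show "Gamma_map (1 / q) ` IFV \<subseteq> QROFN q"
    using assms by (auto simp: IFV_def QROFN_def Gamma_map_def powr_powr powr_le1)
qed

lemma less_LW_iff_less_XY_Gamma_map:
  "less_LW q \<alpha> \<beta> \<longleftrightarrow> less_XY (Gamma_map q \<alpha>) (Gamma_map q \<beta>)"
  by (simp add: less_LW_def less_XY_def s_LW_def h_LW_def s_IFV_def h_IFV_def
      Gamma_map_def split_beta)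

theorem theorem6p1:
  fixes q :: real
  assumes "q \<ge> 1"
  shows "poset_isomorphism (QROFN q) (le_LW q) IFV le_XY (Gamma_map q)"
proof (rule poset_isomorphism_order_embedding)
  show bij: "bij_betw (Gamma_map q) (QROFN q) IFV"
    using assms by (intro bij_betw_Gamma_map) simp
  show "poset_on IFV le_XY"
    by (rule poset_on_le_XY)
  show "le_LW q \<alpha> \<beta> \<longleftrightarrow> le_XY (Gamma_map q \<alpha>) (Gamma_map q \<beta>)"
    if "\<alpha> \<in> QROFN q" "\<beta> \<in> QROFN q" for \<alpha> \<beta>
    \<comment> \<open>The strict disjuncts agree for all pairs; matching the equality disjuncts
      takes injectivity on \<open>QROFN q\<close>.\<close>
    using that inj_on_eq_iff[OF bij_betw_imp_inj_on[OF bij], of \<alpha> \<beta>]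
    unfolding le_LW_def le_XY_def less_LW_iff_less_XY_Gamma_map by blast
qed

end
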